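(* Let $X$ and $Y$ be topological spaces that are ir-homotopy equivalent. Then $\mathrm{Cat}_{ir}(X)=\mathrm{Cat}_{ir}(Y)$.
   Context: $I_{ir}$ denotes the set $[0,1]$ with the left order topology, whose open sets are exactly $[0,b)$ for $0\le b\le 1$ (including $\emptyset$) and $[0,1]$. For continuous maps $f,g:X\to Y$, an ir-homotopy from $f$ to $g$ is a continuous map $F:X\times I_{ir}\to Y$ (product topology) with $F(x,0)=f(x)$ and $F(x,1)=g(x)$ for all $x\in X$; write $f\cong_{ir} g$ if one exists (this relation is directed, from $f$ to $g$). Spaces $X$ and $Y$ are ir-homotopy equivalent if there exist continuous maps $f:X\to Y$ and $g:Y\to X$ with $1_X\cong_{ir} g\circ f$ and $1_Y\cong_{ir} f\circ g$. A space $X$ is ir-contractible in $x_0\in X$ if there is an ir-homotopy from the identity $1_X$ to the constant map $X\to X$ with value $x_0$; $X$ is ir-contractible if it is so in some $x_0\in X$. The Lusternik-Schnirelmann ir-category $\mathrm{Cat}_{ir}(X)$ is the least non-negative integer $n$ such that $X$ has an open cover $U_1,\dots,U_n$ with each $U_i$ (with the subspace topology) ir-contractible; $\mathrm{Cat}_{ir}(X)=\infty$ if no such $n$ exists. *)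

theory Defs
  imports "HOL-Analysis.Analysis" "HOL-Library.Extended_Nat"
begin

definition ir_interval :: "real topology" where
  "ir_interval = topology (\<lambda>S. S = {0..1} \<or> (\<exists>b\<in>{0..1}. S = {0..<b}))"

text \<open>The predicate above is a topology, so \<^const>\<open>ir_interval\<close> has exactly these open sets.\<close>

lemma istopology_ir_interval:
  "istopology (\<lambda>S::real set. S = {0..1} \<or> (\<exists>b\<in>{0..1}. S = {0..<b}))"
  (is "istopology ?P")
  unfolding istopology_def
proof (intro conjI allI impI)
  fix S T :: "real set"
  assume S: "?P S" and T: "?P T"
  show "?P (S \<inter> T)"
  proof (cases "S = {0..1} \<or> T = {0..1}")
    case True
    have "S \<subseteq> {0..1}" "T \<subseteq> {0..1}"
      using S T by auto
    then have "S \<inter> T = S \<or> S \<inter> T = T"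
      using True by blast
    then show ?thesis
    proof
      assume "S \<inter> T = S"
      with S show ?thesis
        by simp
    next
      assume "S \<inter> T = T"
      with T show ?thesis
        by simp
    qed
  next
    case False
    then obtain a b where "a \<in> {0..1}" "b \<in> {0..1}" "S = {0..<a}" "T = {0..<b}"
      using S T by blast
    then have "min a b \<in> {0..1}" "S \<inter> T = {0..<min a b}"
      by auto
    then show ?thesis
      by blast
  qed
next
  fix \<K> :: "real set set"
  assume K: "\<forall>S\<in>\<K>. ?P S"
  show "?P (\<Union>\<K>)"
  proof (cases "{0..1} \<in> \<K>")
    case True
    have "S \<subseteq> {0..1}" if "S \<in> \<K>" for S
    proof -
      have "?P S"
        using K that by blast
      then show ?thesis
        by auto
    qed
    with True have "\<Union>\<K> = {0..1}"
      by blast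
    then show ?thesis
      by blast
  next
    case False
    define B where "B = insert 0 {b \<in> {0..1}. {0..<b} \<in> \<K>}"
    have "0 \<in> B" and sub: "B \<subseteq> {0..1}"
      by (auto simp: B_def)
    have "bdd_above B"
      by (rule bdd_above_mono[OF bdd_above_Icc sub])
    with \<open>0 \<in> B\<close> sub have B: "B \<noteq> {}" "bdd_above B" "B \<subseteq> {0..1}"
      by blast+
    have "0 \<le> Sup B"
      using \<open>0 \<in> B\<close> B(2) by (rule cSup_upper)
    moreover have "Sup B \<le> 1"
      using B(1,3) by (intro cSup_least) auto
    ultimately have "Sup B \<in> {0..1}"
      by simp
    moreover have "\<Union>\<K> = {0..<Sup B}"
    proof (intro equalityI subsetI)
      fix x assume "x \<in> \<Union>\<K>"
      then obtain S where S: "S \<in> \<K>" "x \<in> S"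
        by blast
      then have "S \<noteq> {0..1}" "?P S"
        using K False by metis+
      then obtain b where "b \<in> {0..1}" "S = {0..<b}"
        by blast
      with S have "b \<in> {0..1}" "{0..<b} \<in> \<K>" "x \<in> {0..<b}"
        by simp_all
      then have "b \<in> B"
        unfolding B_def by blast
      then have "b \<le> Sup B"
        using B(2) by (rule cSup_upper)
      with \<open>x \<in> {0..<b}\<close> show "x \<in> {0..<Sup B}"
        by simp
    next
      fix x assume "x \<in> {0..<Sup B}"
      then have "x < Sup B" "0 \<le> x"
        by simp_all
      then obtain b where b: "b \<in> B" "x < b"
        using less_cSup_iff[OF B(1,2)] by blast
      with \<open>0 \<le> x\<close> have "b \<noteq> 0" "x \<in> {0..<b}"
        by simp_all
      with b have "{0..<b} \<in> \<K>"
        unfolding B_def by blast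
      with \<open>x \<in> {0..<b}\<close> show "x \<in> \<Union>\<K>"
        by blast
    qed
    ultimately show ?thesis
      by blast
  qed
qed

lemma openin_ir_interval:
  "openin ir_interval S \<longleftrightarrow> S = {0..1} \<or> (\<exists>b\<in>{0..1}. S = {0..<b})"
  unfolding ir_interval_def using istopology_ir_interval by (simp add: topology_inverse')

lemma topspace_ir_interval: "topspace ir_interval = {0..1}"
proof
  show "topspace ir_interval \<subseteq> {0..1}"
    unfolding topspace_def by (auto simp: openin_ir_interval)
  show "{0..1} \<subseteq> topspace ir_interval"
    by (intro openin_subset) (simp add: openin_ir_interval)
qed

definition ir_homotopic ::
    "'a topology \<Rightarrow> 'b topology \<Rightarrow> ('a \<Rightarrow> 'b) \<Rightarrow> ('a \<Rightarrow> 'b) \<Rightarrow> bool" where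
  "ir_homotopic X Y f g \<longleftrightarrow>
     continuous_map X Y f \<and> continuous_map X Y g \<and>
     (\<exists>F. continuous_map (prod_topology X ir_interval) Y F \<and>
          (\<forall>x\<in>topspace X. F (x, 0) = f x) \<and> (\<forall>x\<in>topspace X. F (x, 1) = g x))"

definition ir_homotopy_equivalent :: "'a topology \<Rightarrow> 'b topology \<Rightarrow> bool" where
  "ir_homotopy_equivalent X Y \<longleftrightarrow>
     (\<exists>f g. continuous_map X Y f \<and> continuous_map Y X g \<and>
            ir_homotopic X X id (g \<circ> f) \<and> ir_homotopic Y Y id (f \<circ> g))"

definition ir_contractible_in :: "'a topology \<Rightarrow> 'a \<Rightarrow> bool" where
  "ir_contractible_in X x0 \<longleftrightarrow> x0 \<in> topspace X \<and> ir_homotopic X X id (\<lambda>x. x0)"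

definition ir_contractible :: "'a topology \<Rightarrow> bool" where
  "ir_contractible X \<longleftrightarrow> (\<exists>x0. ir_contractible_in X x0)"

text \<open>In \<^typ>\<open>enat\<close> a nonempty set attains its infimum, and the infimum of the empty set is
  \<open>\<infinity>\<close>. The empty space is covered by the empty family, so its category is \<open>0\<close>.\<close>

definition ir_category :: "'a topology \<Rightarrow> enat" where
  "ir_category X =
     Inf {enat n | n. \<exists>U :: nat \<Rightarrow> 'a set.
            (\<forall>i\<in>{1..n}. openin X (U i) \<and> ir_contractible (subtopology X (U i))) \<and>
            (\<Union>i\<in>{1..n}. U i) = topspace X}"

end

theory Submission
  imports Defs
begin

text \<open>The only neighbourhood of \<open>1\<close> in \<^const>\<open>ir_interval\<close> is the whole interval, so an ir-homotopy
  from \<open>f\<close> to \<open>g\<close> exists iff \<open>f x\<close> lies in every open neighbourhood of \<open>g x\<close>, for all \<open>x\<close>.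
  Hence an open set is ir-contractible iff it is the smallest open neighbourhood of one of its points.
  Given maps \<open>f\<close>, \<open>g\<close> that form an ir-homotopy equivalence and a finite cover of \<open>X\<close> by smallest
  neighbourhoods \<open>U i\<close> of points \<open>p i\<close>, we may enlarge each \<open>U i\<close> to a maximal member of the cover.
  Maximality forces \<open>g (f (p i)) \<in> U i\<close>, and then the preimage of \<open>U i\<close> under \<open>g\<close> is the smallest
  neighbourhood of \<open>f (p i)\<close>.\<close>

lemma ir_homotopic_iff:
  "ir_homotopic X Y f g \<longleftrightarrow>
     continuous_map X Y f \<and> continuous_map X Y g \<and>
     (\<forall>x\<in>topspace X. \<forall>V. openin Y V \<and> g x \<in> V \<longrightarrow> f x \<in> V)"
    (is "_ \<longleftrightarrow> _ \<and> _ \<and> ?spec")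
proof
  assume *: "ir_homotopic X Y f g"
  then obtain F where cf: "continuous_map X Y f" and cg: "continuous_map X Y g"
    and F: "continuous_map (prod_topology X ir_interval) Y F"
      "\<And>x. x \<in> topspace X \<Longrightarrow> F (x, 0) = f x" "\<And>x. x \<in> topspace X \<Longrightarrow> F (x, 1) = g x"
    unfolding ir_homotopic_def by blast
  have "f x \<in> V" if x: "x \<in> topspace X" and V: "openin Y V" "g x \<in> V" for x V
  proof -
    let ?P = "{z \<in> topspace (prod_topology X ir_interval). F z \<in> V}"
    have "openin (prod_topology X ir_interval) ?P"
      using F(1) V(1) by (rule openin_continuous_map_preimage)
    moreover have "(x, 1) \<in> ?P"
      using x V(2) F(3) by (simp add: topspace_ir_interval)
    ultimately obtain S T where "openin ir_interval T" "x \<in> S" "1 \<in> T" "S \<times> T \<subseteq> ?P"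
      unfolding openin_prod_topology_alt by meson
    moreover from this have "T = {0..1}"
      by (auto simp: openin_ir_interval)
    ultimately have "(x, 0) \<in> ?P"
      by (meson SigmaI atLeastAtMost_iff order_refl subsetD zero_le_one)
    then show ?thesis
      using F(2)[OF x] by simp
  qed
  with cf cg show "continuous_map X Y f \<and> continuous_map X Y g \<and> ?spec"
    by blast
next
  assume *: "continuous_map X Y f \<and> continuous_map X Y g \<and> ?spec"
  \<comment> \<open>The homotopy stays at \<open>f\<close> for all times before \<open>1\<close> and
    jumps to \<open>g\<close> at time \<open>1\<close>.\<close>
  define F where "F = (\<lambda>(x, t::real). if t < 1 then f x else g x)"
  have "continuous_map (prod_topology X ir_interval) Y F"
    unfolding continuous_map_def
  proof (intro conjI allI impI)
    show "F \<in> topspace (prod_topology X ir_interval) \<rightarrow> topspace Y"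
      using * by (auto simp: F_def continuous_map_def)
    fix V assume V: "openin Y V"
    let ?A = "{x \<in> topspace X. f x \<in> V}" and ?B = "{x \<in> topspace X. g x \<in> V}"
    have "openin X ?A" "openin X ?B"
      using * V by (auto intro: openin_continuous_map_preimage)
    moreover have "openin ir_interval {0..<1}" "openin ir_interval {0..1}"
      by (auto simp: openin_ir_interval)
    ultimately have "openin (prod_topology X ir_interval) (?A \<times> {0..<1} \<union> ?B \<times> {0..1})"
      by (intro openin_Un) (simp_all add: openin_prod_Times_iff)
    \<comment> \<open>The slice of the preimage at time \<open>1\<close> is only \<open>?B\<close>.
      The hypothesis gives \<open>?B\<close> \<subseteq> \<open>?A\<close>, so thickening
      \<open>?B\<close> to all times adds no points and makes the set visibly open.\<close>
    moreover have "{z \<in> topspace (prod_topology X ir_interval). F z \<in> V}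
        = ?A \<times> {0..<1} \<union> ?B \<times> {0..1}"
      using * V by (auto simp: F_def topspace_ir_interval split: if_splits)
    ultimately show "openin (prod_topology X ir_interval)
        {z \<in> topspace (prod_topology X ir_interval). F z \<in> V}"
      by simp
  qed
  moreover have "F (x, 0) = f x" "F (x, 1) = g x" for x
    by (simp_all add: F_def)
  ultimately show "ir_homotopic X Y f g"
    using * unfolding ir_homotopic_def by blast
qed

text \<open>Such a \<open>U\<close> is the intersection of all open neighbourhoods of
  \<open>p\<close>, required to be open; equivalently, it is an open set consisting of the points
  whose closure contains \<open>p\<close>.\<close>

definition smallest_nbhd :: "'a topology \<Rightarrow> 'a \<Rightarrow> 'a set \<Rightarrow> bool" where
  "smallest_nbhd X p U \<longleftrightarrow>
     openin X U \<and> p \<in> U \<and> (\<forall>V. openin X V \<and> p \<in> V \<longrightarrow> U \<subseteq> V)"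

text \<open>For the identity and the constant map \<open>p\<close>, \<open>ir_homotopic_iff\<close>
  says that every point of \<open>U\<close> lies in every relatively open set around
  \<open>p\<close>. As \<open>U\<close> is open in \<open>X\<close>, testing these sets amounts to
  testing all open sets of \<open>X\<close> around \<open>p\<close>.\<close>

lemma ir_contractible_open_iff:
  "openin X U \<and> ir_contractible (subtopology X U) \<longleftrightarrow> (\<exists>p. smallest_nbhd X p U)"
proof (cases "openin X U")
  case True
  then have top: "topspace (subtopology X U) = U"
    by (intro topspace_subtopology_subset openin_subset)
  have "ir_contractible_in (subtopology X U) p \<longleftrightarrow> smallest_nbhd X p U" for p
  proof
    assume *: "ir_contractible_in (subtopology X U) p"
    then have "p \<in> U"
      by (simp add: ir_contractible_in_def top)
    moreover have "U \<subseteq> V" if V: "openin X V" "p \<in> V" for V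
    proof
      fix x assume "x \<in> U"
      moreover have "openin (subtopology X U) (U \<inter> V)"
        using V(1) by (simp add: openin_subtopology_Int2)
      moreover have "p \<in> U \<inter> V"
        using V(2) \<open>p \<in> U\<close> by simp
      ultimately have "id x \<in> U \<inter> V"
        using * unfolding ir_contractible_in_def ir_homotopic_iff top by blast
      then show "x \<in> V"
        by simp
    qed
    ultimately show "smallest_nbhd X p U"
      using True by (simp add: smallest_nbhd_def)
  next
    assume "smallest_nbhd X p U"
    then show "ir_contractible_in (subtopology X U) p"
      unfolding smallest_nbhd_def ir_contractible_in_def ir_homotopic_iff top
        openin_open_subtopology[OF True]
      using openin_subset[OF True] by (auto simp: top)
  qed
  with True show ?thesis
    by (simp add: ir_contractible_def)
qed (auto simp: smallest_nbhd_def)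

text \<open>If \<open>V\<close> is an open set around \<open>f p\<close>, its preimage under
  \<open>f\<close> is one around \<open>p\<close> and so contains \<open>U\<close>. Hence
  \<open>g y\<close> in \<open>U\<close> gives \<open>f (g y)\<close> in \<open>V\<close>, and the
  homotopy from \<open>id\<close> to \<open>f \<circ> g\<close> brings \<open>y\<close> itself into
  \<open>V\<close>.\<close>

lemma smallest_nbhd_preimage:
  assumes f: "continuous_map X Y f" and g: "continuous_map Y X g"
    and fg: "ir_homotopic Y Y id (f \<circ> g)"
    and U: "smallest_nbhd X p U" and p: "g (f p) \<in> U"
  shows "smallest_nbhd Y (f p) {y \<in> topspace Y. g y \<in> U}"
  unfolding smallest_nbhd_def
proof (intro conjI allI impI)
  have "openin X U" "p \<in> U"
    using U by (auto simp: smallest_nbhd_def)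
  then have px: "p \<in> topspace X"
    using openin_subset by blast
  show "openin Y {y \<in> topspace Y. g y \<in> U}"
    using g \<open>openin X U\<close> by (rule openin_continuous_map_preimage)
  show "f p \<in> {y \<in> topspace Y. g y \<in> U}"
    using f px p by (auto simp: continuous_map_def)
  fix V assume V: "openin Y V \<and> f p \<in> V"
  then have "openin X {x \<in> topspace X. f x \<in> V}" "p \<in> {x \<in> topspace X. f x \<in> V}"
    using f px by (auto intro: openin_continuous_map_preimage)
  then have "U \<subseteq> {x \<in> topspace X. f x \<in> V}"
    using U by (auto simp: smallest_nbhd_def)
  then show "{y \<in> topspace Y. g y \<in> U} \<subseteq> V"
    using fg V by (auto simp: ir_homotopic_iff)
qed

definition ir_covering_number :: "'a topology \<Rightarrow> nat \<Rightarrow> bool" where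
  "ir_covering_number X n \<longleftrightarrow>
     (\<exists>U. (\<forall>i\<in>{1..n}. \<exists>p. smallest_nbhd X p (U i)) \<and> (\<Union>i\<in>{1..n}. U i) = topspace X)"

lemma ir_category_eq: "ir_category X = Inf (enat ` Collect (ir_covering_number X))"
  unfolding ir_category_def ir_covering_number_def ir_contractible_open_iff
  by (rule arg_cong[where f = Inf]) blast

text \<open>Every admissible \<open>n\<close> is transferred, not only the least one, so the case of
  infinite category needs no separate treatment.\<close>

lemma ir_covering_number_transfer:
  assumes "ir_homotopy_equivalent X Y" and "ir_covering_number X n"
  shows "ir_covering_number Y n"
proof -
  obtain f g where f: "continuous_map X Y f" and g: "continuous_map Y X g"
    and gf: "ir_homotopic X X id (g \<circ> f)" and fg: "ir_homotopic Y Y id (f \<circ> g)"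
    using assms(1) unfolding ir_homotopy_equivalent_def by blast
  obtain U where nb: "\<forall>i\<in>{1..n}. \<exists>p. smallest_nbhd X p (U i)"
    and cover: "(\<Union>i\<in>{1..n}. U i) = topspace X"
    using assms(2) unfolding ir_covering_number_def by blast
  \<comment> \<open>Different indices may receive the same maximal set. Repetitions are allowed in a
    cover, so the number \<open>n\<close> is kept.\<close>
  have "\<forall>i\<in>{1..n}. \<exists>M \<in> U ` {1..n}. U i \<subseteq> M \<and> (\<forall>B \<in> U ` {1..n}. M \<subseteq> B \<longrightarrow> M = B)"
    by (intro ballI finite_has_maximal2) auto
  then obtain M where M: "\<And>i. i \<in> {1..n} \<Longrightarrow> M i \<in> U ` {1..n}"
      "\<And>i. i \<in> {1..n} \<Longrightarrow> U i \<subseteq> M i"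
      "\<And>i j. i \<in> {1..n} \<Longrightarrow> j \<in> {1..n} \<Longrightarrow> M i \<subseteq> U j \<Longrightarrow> M i = U j"
    by (metis imageI)
  let ?W = "\<lambda>i. {y \<in> topspace Y. g y \<in> M i}"
  have "\<exists>q. smallest_nbhd Y q (?W i)" if i: "i \<in> {1..n}" for i
  proof -
    obtain p where p: "smallest_nbhd X p (M i)"
      using M(1)[OF i] nb by auto
    then have px: "p \<in> topspace X"
      unfolding smallest_nbhd_def using openin_subset by blast
    then have "g (f p) \<in> topspace X"
      using f g by (auto simp: continuous_map_def)
    then obtain j where j: "j \<in> {1..n}" "g (f p) \<in> U j"
      using cover by blast
    then have Uj: "openin X (U j)"
      using nb by (auto simp: smallest_nbhd_def)
    \<comment> \<open>The homotopy from \<open>id\<close> to \<open>g \<circ> f\<close> puts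
      \<open>p\<close> into every open set around \<open>g (f p)\<close>. Now \<open>U j\<close> is
      an open set around \<open>p\<close>, so it contains the smallest one, \<open>M i\<close>, and
      maximality makes the two equal.\<close>
    then have "p \<in> U j"
      using gf px j(2) by (auto simp: ir_homotopic_iff)
    with Uj p have "M i \<subseteq> U j"
      by (simp add: smallest_nbhd_def)
    with M(3)[OF i j(1)] j(2) have "g (f p) \<in> M i"
      by simp
    with f g fg p show ?thesis
      by (blast intro: smallest_nbhd_preimage)
  qed
  moreover have "(\<Union>i\<in>{1..n}. ?W i) = topspace Y"
  proof -
    have "\<exists>i\<in>{1..n}. g y \<in> M i" if "y \<in> topspace Y" for y
    proof -
      have "g y \<in> topspace X"
        using g that by (auto simp: continuous_map_def)
      with cover M(2) show ?thesis
        by blast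
    qed
    then show ?thesis
      by blast
  qed
  ultimately show ?thesis
    unfolding ir_covering_number_def by (intro exI[of _ ?W] conjI ballI)
qed

lemma ir_homotopy_equivalent_sym:
  "ir_homotopy_equivalent X Y \<Longrightarrow> ir_homotopy_equivalent Y X"
  unfolding ir_homotopy_equivalent_def by blast

theorem theorem15:
  fixes X :: "'a topology" and Y :: "'b topology"
  assumes "ir_homotopy_equivalent X Y"
  shows "ir_category X = ir_category Y"
proof -
  have "ir_covering_number X = ir_covering_number Y"
  proof
    fix n
    show "ir_covering_number X n \<longleftrightarrow> ir_covering_number Y n"
      using ir_covering_number_transfer[OF assms]
        ir_covering_number_transfer[OF ir_homotopy_equivalent_sym[OF assms]] by (rule iffI)
  qed
  then show ?thesis
    by (simp add: ir_category_eq)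
qed

end
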